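(* Let $n,d$ be positive integers. (i) If $d\ge 3$ and $n\ge 2d-1$, then for every $k=1,\dots,d-2$, $EI^k(\hat{\mathcal C}_n^d)=\hat{\mathcal C}_n^{d-k}\cup\hat{\mathcal C}_n^{d-k-1}\cup\dots\cup\hat{\mathcal C}_n^{2}$. (ii) If $d\ge 2$ and $n\ge 2d-1$, then $k^{EI}(\hat{\mathcal C}_n^d)=d-1$. (iii) If $d\ge 2$ and $n\ge d$, then $k^{EI}(\hat{\mathcal P}_n^d)=d-1$ when $n\ge 2d-1$, and $k^{EI}(\hat{\mathcal P}_n^d)=n-d+1$ when $n<2d-1$.
   Context: A hypergraph $\mathcal H=(V,\mathcal E)$ consists of a finite vertex set and a set of subsets of it (hyperedges). Its edge intersection hypergraph is $EI(\mathcal H)=(V,\mathcal E^{EI})$ with $\mathcal E^{EI}=\{e_1\cap e_2 \mid e_1,e_2\in\mathcal E,\ e_1\neq e_2,\ |e_1\cap e_2|\ge 2\}$; $EI^0(\mathcal H)=\mathcal H$ and $EI^k(\mathcal H)=EI(EI^{k-1}(\mathcal H))$ for $k\ge1$. The EI-number $k^{EI}(\mathcal H)$ is the smallest nonnegative integer $k$ such that $EI^k(\mathcal H)$ has no hyperedges. The strong $d$-uniform hypercycle $\hat{\mathcal C}_n^d$ has vertex set $\{v_1,\dots,v_n\}$ and hyperedges $e_i=\{v_i,v_{i+1},\dots,v_{i+d-1}\}$ for $i=1,\dots,n$ (indices modulo $n$). The strong $d$-uniform hyperpath $\hat{\mathcal P}_n^d$ has vertex set $\{v_1,\dots,v_n\}$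 and hyperedges $e_i=\{v_i,\dots,v_{i+d-1}\}$ for $i=1,\dots,n-d+1$. The union of hypergraphs on the same vertex set is the hypergraph on that vertex set whose edge set is the union of their edge sets. *)

theory Defs
  imports Main
begin

datatype 'a hypergraph = Hypergraph (verts: "'a set") (edges: "'a set set")

definition is_hypergraph :: "'a hypergraph \<Rightarrow> bool" where
  "is_hypergraph H \<longleftrightarrow> finite (verts H) \<and> edges H \<subseteq> Pow (verts H)"

definition EI :: "'a hypergraph \<Rightarrow> 'a hypergraph" where
  "EI H = Hypergraph (verts H)
     {e1 \<inter> e2 | e1 e2. e1 \<in> edges H \<and> e2 \<in> edges H \<and> e1 \<noteq> e2 \<and> card (e1 \<inter> e2) \<ge> 2}"

text \<open>The set minimised over is nonempty for every \<^const>\<open>is_hypergraph\<close>;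
  see lemma \<open>EI_eventually_edgeless\<close> below.\<close>

definition EI_number :: "'a hypergraph \<Rightarrow> nat" where
  "EI_number H = (LEAST k. edges ((EI ^^ k) H) = {})"

text \<open>Only used for nonempty families whose members all have the same vertex set; the
  union of the vertex sets is then that common vertex set.\<close>

definition hypergraph_Union :: "'a hypergraph set \<Rightarrow> 'a hypergraph" where
  "hypergraph_Union F = Hypergraph (\<Union>H\<in>F. verts H) (\<Union>H\<in>F. edges H)"

text \<open>The vertex \<open>v\<^sub>i\<close> is the number \<open>i\<close>. Indices modulo \<open>n\<close> are represented in
  \<open>{1..n}\<close>, so \<open>n\<close> stays \<open>n\<close> and \<open>n + 1\<close> becomes \<open>1\<close>.\<close>

definition cyclic_index :: "nat \<Rightarrow> nat \<Rightarrow> nat" where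
  "cyclic_index n j = (j - 1) mod n + 1"

definition hypercycle :: "nat \<Rightarrow> nat \<Rightarrow> nat hypergraph" where
  "hypercycle n d = Hypergraph {1..n} {cyclic_index n ` {i..<i + d} | i. i \<in> {1..n}}"

text \<open>For \<open>d \<le> n\<close> the range of \<open>i\<close> is \<open>{1..n - d + 1}\<close>; there is no edge for \<open>n < d\<close>.\<close>

definition hyperpath :: "nat \<Rightarrow> nat \<Rightarrow> nat hypergraph" where
  "hyperpath n d = Hypergraph {1..n} {{i..<i + d} | i. 1 \<le> i \<and> i + d \<le> n + 1}"

lemma is_hypergraph_EI: "is_hypergraph H \<Longrightarrow> is_hypergraph (EI H)"
  by (auto simp: is_hypergraph_def EI_def)

lemma is_hypergraph_hypercycle: "is_hypergraph (hypercycle n d)"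
  by (auto simp: is_hypergraph_def hypercycle_def cyclic_index_def Suc_le_eq)

lemma is_hypergraph_hyperpath: "is_hypergraph (hyperpath n d)"
  by (auto simp: is_hypergraph_def hyperpath_def)

lemma card_edge_EI_power:
  assumes "is_hypergraph H" "e \<in> edges ((EI ^^ k) H)"
  shows "card e + k \<le> card (verts H)"
proof -
  have hyp: "is_hypergraph ((EI ^^ k) H)" for k
    by (induction k) (simp_all add: assms(1) is_hypergraph_EI)
  have verts: "verts ((EI ^^ k) H) = verts H" for k
    by (induction k) (simp_all add: EI_def)
  show ?thesis using assms(2)
  proof (induction k arbitrary: e)
    case 0
    then show ?case
      using assms(1) by (auto simp: is_hypergraph_def intro: card_mono)
  next
    case (Suc k)
    have "e \<in> edges (EI ((EI ^^ k) H))" using Suc.prems by simp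
    then obtain e1 e2 where
      e: "e = e1 \<inter> e2" "e1 \<in> edges ((EI ^^ k) H)" "e2 \<in> edges ((EI ^^ k) H)" "e1 \<noteq> e2"
      unfolding EI_def hypergraph.sel by blast
    have fin: "finite e1" "finite e2"
      using hyp[of k] e by (auto simp: is_hypergraph_def dest: finite_subset)
    from e have "e \<subset> e1 \<or> e \<subset> e2" by blast
    with fin have "card e < card e1 \<or> card e < card e2" by (blast intro: psubset_card_mono)
    with Suc.IH[OF e(2)] Suc.IH[OF e(3)] show ?case by auto
  qed
qed

lemma EI_eventually_edgeless:
  assumes "is_hypergraph H"
  shows "\<exists>k. edges ((EI ^^ k) H) = {}"
  using card_edge_EI_power[OF assms, of _ "Suc (card (verts H))"] by fastforce

end

theory Submission
  imports Defs
begin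

text \<open>
  Intersecting two distinct sets of size at most \<open>m\<close> gives a set of size less than \<open>m\<close>, so
  edges of \<open>EI\<^sup>k\<close> of a \<open>d\<close>-uniform hypergraph have at most \<open>d - k\<close> elements; being of size at
  least 2, they are gone after \<open>d - 1\<close> steps. Shifting an edge by one and intersecting shows that
  this is sharp as long as there is room for shifts. On a cycle with \<open>n \<ge> 2d - 1\<close> there is always
  room, and two arcs of length at most \<open>d\<close> cannot meet at both ends, so their intersection is
  again an arc. On a path with \<open>n < 2d - 1\<close>, all edges contain the central block
  \<open>{n - d + 1..d}\<close> of size \<open>2d - n\<close>, so the bound \<open>d - k\<close> on the size stops the process already
  after \<open>n - d + 1\<close> steps.
\<close>

section \<open>Iterated edge intersection hypergraphs\<close>

lemma verts_EI_power [simp]: "verts ((EI ^^ k) H) = verts H"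
  by (induction k) (simp_all add: EI_def)

lemma edges_EI_iff:
  "e \<in> edges (EI H) \<longleftrightarrow>
     (\<exists>e1 e2. e = e1 \<inter> e2 \<and> e1 \<in> edges H \<and> e2 \<in> edges H \<and> e1 \<noteq> e2 \<and> card e \<ge> 2)"
  by (auto simp: EI_def)

lemma card_edge_EI_power_ge_2: "e \<in> edges ((EI ^^ Suc k) H) \<Longrightarrow> card e \<ge> 2"
  by (auto simp: edges_EI_iff)

lemma edge_EI_power_upper:
  assumes "\<And>e. e \<in> edges H \<Longrightarrow> finite e \<and> card e \<le> d"
    and "e \<in> edges ((EI ^^ k) H)"
  shows "finite e \<and> card e + k \<le> d"
  using assms(2)
proof (induction k arbitrary: e)
  case 0
  then show ?case using assms(1) by simp
next
  case (Suc k)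
  then obtain e1 e2 where e: "e = e1 \<inter> e2" "e1 \<in> edges ((EI ^^ k) H)"
      "e2 \<in> edges ((EI ^^ k) H)" "e1 \<noteq> e2"
    by (auto simp: edges_EI_iff)
  note IH = Suc.IH[OF e(2)] Suc.IH[OF e(3)]
  from e have "e \<subset> e1 \<or> e \<subset> e2" by blast
  with IH have "card e < card e1 \<or> card e < card e2" by (blast intro: psubset_card_mono)
  with IH e(1) show ?case by auto
qed

text \<open>Serves the short hyperpaths, with \<open>C\<close> the central block: a common subset
  bounds edge sizes from below on every level.\<close>

lemma edge_EI_power_supset:
  assumes "\<And>e. e \<in> edges H \<Longrightarrow> C \<subseteq> e" "e \<in> edges ((EI ^^ k) H)"
  shows "C \<subseteq> e"
  using assms(2)
proof (induction k arbitrary: e)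
  case 0
  then show ?case using assms(1) by simp
next
  case (Suc k)
  then show ?case by (fastforce simp: edges_EI_iff)
qed

lemma EI_power_edgeless_mono:
  assumes "edges ((EI ^^ k) H) = {}" "k \<le> m"
  shows "edges ((EI ^^ m) H) = {}"
  using assms(2,1) by (induction m rule: dec_induct) (auto simp: edges_EI_iff)

text \<open>Edgelessness persists, so an edgeless level right after a nonempty one is the
  first.\<close>

lemma EI_number_eqI:
  assumes "edges ((EI ^^ Suc m) H) = {}" "edges ((EI ^^ m) H) \<noteq> {}"
  shows "EI_number H = Suc m"
  unfolding EI_number_def
proof (rule Least_equality)
  fix k
  assume "edges ((EI ^^ k) H) = {}"
  with assms(2) show "Suc m \<le> k"
    using EI_power_edgeless_mono not_less_eq_eq by blast
qed (fact assms(1))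

lemma EI_power_uniform_edgeless:
  assumes "\<And>e. e \<in> edges H \<Longrightarrow> finite e \<and> card e \<le> d" "d \<ge> 2"
  shows "edges ((EI ^^ (d - 1)) H) = {}"
proof -
  \<comment> \<open>Writing the level as \<open>Suc (d - 2)\<close> shows it to be positive, so its
    edges have at least 2 elements.\<close>
  have False if e: "e \<in> edges ((EI ^^ Suc (d - 2)) H)" for e
    using edge_EI_power_upper[OF assms(1) e] card_edge_EI_power_ge_2[OF e] assms(2) by linarith
  moreover have "Suc (d - 2) = d - 1" using assms(2) by simp
  ultimately show ?thesis by auto
qed

section \<open>Arcs of a cycle\<close>

text \<open>The start may exceed \<open>n\<close>, so arcs can be moved by full turns and compared
  as plain intervals.\<close>

definition arc :: "nat \<Rightarrow> nat \<Rightarrow> nat \<Rightarrow> nat set" where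
  "arc n i l = cyclic_index n ` {i..<i + l}"

lemma cyclic_index_eqD:
  assumes "cyclic_index n x = cyclic_index n y" "1 \<le> x" "x \<le> y" "y < x + n"
  shows "x = y"
proof -
  have "n dvd (y - 1) - (x - 1)"
    using assms(1,3) by (intro mod_eq_dvd_iff_nat[THEN iffD1]) (simp_all add: cyclic_index_def)
  then have "n dvd y - x" using assms(2,3) by simp
  then show ?thesis using assms(3,4) by (metis add.commute diff_is_0_eq le_antisym less_diff_conv2
      nat_dvd_not_less neq0_conv)
qed

text \<open>Truncated subtraction gives 0 and 1 the same \<open>cyclic_index\<close>, hence the
  positive start.\<close>

lemma inj_on_cyclic_index:
  assumes "1 \<le> i"
  shows "inj_on (cyclic_index n) {i..<i + n}"
proof (rule inj_onI)
  fix x y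
  assume "x \<in> {i..<i + n}" "y \<in> {i..<i + n}" "cyclic_index n x = cyclic_index n y"
  then show "x = y"
    using cyclic_index_eqD[of n x y] cyclic_index_eqD[of n y x] assms by (cases "x \<le> y") auto
qed

lemma finite_arc [simp]: "finite (arc n i l)"
  by (simp add: arc_def)

lemma card_arc: "1 \<le> i \<Longrightarrow> l \<le> n \<Longrightarrow> card (arc n i l) = l"
  unfolding arc_def by (subst card_image) (auto intro: inj_on_subset[OF inj_on_cyclic_index])

lemma arc_add_mult:
  assumes "1 \<le> i"
  shows "arc n (i + n * q) l = arc n i l"
proof -
  have "cyclic_index n (x + n * q) = cyclic_index n x" if "1 \<le> x" for x
  proof -
    have "x + n * q - 1 = (x - 1) + n * q" using that by simp
    then show ?thesis unfolding cyclic_index_def by simp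
  qed
  moreover have "{i + n * q..<i + n * q + l} = (\<lambda>x. x + n * q) ` {i..<i + l}"
    by (simp only: image_add_atLeastLessThan' add_ac)
  ultimately show ?thesis
    unfolding arc_def image_image using assms by (simp only: image_image) (rule image_cong, auto)
qed

lemma arc_normalize:
  assumes "1 \<le> i"
  shows "arc n i l = arc n (cyclic_index n i) l"
proof -
  have "cyclic_index n i + n * ((i - 1) div n) = i"
    using assms by (simp add: cyclic_index_def)
  then show ?thesis
    using arc_add_mult[of "cyclic_index n i" n "(i - 1) div n" l] by (simp add: cyclic_index_def)
qed

lemma edges_hypercycle:
  assumes "n > 0"
  shows "edges (hypercycle n d) = {arc n i d | i. 1 \<le> i}"
proof -
  have "cyclic_index n i \<in> {1..n}" for i
    using assms by (simp add: cyclic_index_def Suc_le_eq)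
  then show ?thesis
    using arc_normalize[of _ n d] unfolding hypercycle_def hypergraph.sel arc_def[symmetric]
    by (smt (verit) Collect_cong atLeastAtMost_iff)
qed

text \<open>Both intervals lie in \<open>{i..<i + n}\<close>, where \<open>cyclic_index n\<close> is
  injective, so they can be intersected before reduction. If they are disjoint, the truncated
  difference yields length 0.\<close>

lemma arc_Int_window:
  assumes "1 \<le> i" "i \<le> j" "a \<le> n" "j + b \<le> i + n"
  shows "arc n i a \<inter> arc n j b = arc n j (min (i + a) (j + b) - j)"
proof -
  have "arc n i a \<inter> arc n j b = cyclic_index n ` ({i..<i + a} \<inter> {j..<j + b})"
    unfolding arc_def
    by (rule inj_on_image_Int[OF inj_on_cyclic_index[OF assms(1), of n], symmetric])
       (use assms in auto)
  also have "{i..<i + a} \<inter> {j..<j + b} = {j..<j + (min (i + a) (j + b) - j)}"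
    using assms by auto
  finally show ?thesis by (simp add: arc_def)
qed

lemma arc_Int_arc:
  assumes "n \<ge> 2 * d - 1" "a \<le> d" "b \<le> d" "1 \<le> i" "1 \<le> j" "n > 0"
  shows "\<exists>m l. 1 \<le> m \<and> l \<le> d \<and> arc n i a \<inter> arc n j b = arc n m l"
proof -
  have main: "\<exists>m l. 1 \<le> m \<and> l \<le> d \<and> arc n i a \<inter> arc n j b = arc n m l"
    if "a \<le> d" "b \<le> d" "1 \<le> i" "i \<le> j" "j \<le> n" for i j a b
  proof -
    have dn: "d \<le> n" using assms(1,6) by linarith
    show ?thesis
    proof (cases "j + b \<le> i + n")
      case True
      have "arc n i a \<inter> arc n j b = arc n j (min (i + a) (j + b) - j)"
        by (rule arc_Int_window) (use that True dn in auto)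
      moreover have "min (i + a) (j + b) - j \<le> d" using that by auto
      ultimately show ?thesis using that by (meson order_trans)
    next
      case False
      \<comment> \<open>The second arc runs past \<open>i + n\<close>, so
        \<open>n \<ge> 2 * d - 1\<close> forces \<open>i + a \<le> j\<close>: no overlap at the
        other end. One turn later the first arc fits into the window starting at
        \<open>j\<close>.\<close>
      have "arc n j b \<inter> arc n (i + n * 1) a
          = arc n (i + n * 1) (min (j + b) (i + n * 1 + a) - (i + n * 1))"
        by (rule arc_Int_window) (use that False assms(1) dn in auto)
      moreover have "min (j + b) (i + n * 1 + a) - (i + n * 1) \<le> d" "1 \<le> i + n * 1"
        using that by auto
      ultimately show ?thesis
        using arc_add_mult[OF that(3), of n 1 a] by (metis Int_commute)
    qed
  qed
  have bds: "1 \<le> cyclic_index n x" "cyclic_index n x \<le> n" for x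
    using assms(6) by (simp_all add: cyclic_index_def Suc_le_eq)
  \<comment> \<open>Normalized starts lie in \<open>{1..n}\<close>; the two instances of
    \<open>main\<close> cover both orders.\<close>
  show ?thesis
    using main[of a b "cyclic_index n i" "cyclic_index n j"]
      main[of b a "cyclic_index n j" "cyclic_index n i"] assms bds
      arc_normalize[of i n a] arc_normalize[of j n b]
    by (metis Int_commute linorder_le_cases)
qed

text \<open>The arcs of length \<open>l + s\<close> starting at \<open>i - s\<close> and
  \<open>i\<close> overlap in the wanted arc; their union has length \<open>l + 2 * s\<close> and
  must fit into one turn.\<close>

lemma arc_in_EI:
  assumes all: "\<And>j. 1 \<le> j \<Longrightarrow> arc n j (l + s) \<in> edges H"
    and "1 \<le> s" "2 \<le> l" "l + 2 * s \<le> n" "1 \<le> i"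
  shows "arc n i l \<in> edges (EI H)"
proof -
  \<comment> \<open>A full turn is added since \<open>i - s\<close> need not be positive.\<close>
  define j where "j = i + n - s"
  have j: "1 \<le> j" "j + s = i + n * 1" using assms by (auto simp: j_def)
  have "arc n j (l + s) \<inter> arc n (j + s) (l + s)
      = arc n (j + s) (min (j + (l + s)) (j + s + (l + s)) - (j + s))"
    by (rule arc_Int_window) (use assms j in auto)
  moreover have "min (j + (l + s)) (j + s + (l + s)) - (j + s) = l" by simp
  ultimately have Int: "arc n j (l + s) \<inter> arc n (j + s) (l + s) = arc n i l"
    using j(2) arc_add_mult[OF assms(5), of n 1 l] by simp
  \<comment> \<open>Were the two arcs equal, their intersection would have \<open>l + s\<close>
    elements instead of \<open>l\<close>.\<close>
  have "card (arc n j (l + s)) = l + s" "card (arc n i l) = l"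
    using assms j by (auto intro!: card_arc)
  with Int \<open>1 \<le> s\<close> have "arc n j (l + s) \<noteq> arc n (j + s) (l + s)" by auto
  with Int all[OF j(1)] all[of "j + s"] j(1) \<open>card (arc n i l) = l\<close> assms(3) show ?thesis
    by (auto simp: edges_EI_iff)
qed

section \<open>Hypercycles\<close>

lemma hypercycle_edge_card:
  assumes "n \<ge> d" "n > 0" "e \<in> edges (hypercycle n d)"
  shows "finite e \<and> card e \<le> d"
  using assms by (auto simp: edges_hypercycle card_arc)

lemma edge_EI_power_hypercycle_arc:
  assumes "n \<ge> 2 * d - 1" "n > 0" "e \<in> edges ((EI ^^ k) (hypercycle n d))"
  shows "\<exists>i l. 1 \<le> i \<and> l \<le> d \<and> e = arc n i l"
  using assms(3)
proof (induction k arbitrary: e)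
  case 0
  then show ?case using assms(2) by (auto simp: edges_hypercycle)
next
  case (Suc k)
  then obtain e1 e2 where "e = e1 \<inter> e2" "e1 \<in> edges ((EI ^^ k) (hypercycle n d))"
      "e2 \<in> edges ((EI ^^ k) (hypercycle n d))"
    by (auto simp: edges_EI_iff)
  with Suc.IH[of e1] Suc.IH[of e2] show ?case
    using arc_Int_arc[OF assms(1) _ _ _ _ assms(2)] by blast
qed

lemma arc_in_EI_power_hypercycle:
  assumes "n \<ge> 2 * d - 1" "n > 0" "1 \<le> i" "2 \<le> l" "l + Suc k \<le> d"
  shows "arc n i l \<in> edges ((EI ^^ Suc k) (hypercycle n d))"
  using assms(3-5)
proof (induction k arbitrary: i l)
  case 0
  \<comment> \<open>Level 0 has only length \<open>d\<close>, so the shift \<open>d - l\<close> must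
    reach \<open>l\<close> at once; it needs \<open>2 * d - l \<le> n\<close>.\<close>
  have "arc n i l \<in> edges (EI (hypercycle n d))"
    by (rule arc_in_EI[where s = "d - l"]) (use 0 assms(1,2) in \<open>auto simp: edges_hypercycle\<close>)
  then show ?case by simp
next
  case (Suc k)
  \<comment> \<open>All arcs of length \<open>l + 1\<close> are present one level below, so a shift
    by 1 suffices.\<close>
  have "arc n i l \<in> edges (EI ((EI ^^ Suc k) (hypercycle n d)))"
    by (rule arc_in_EI[where s = 1])
      (use Suc.prems assms(1) in \<open>auto simp del: funpow.simps intro!: Suc.IH\<close>)
  then show ?case by simp
qed

lemma edges_EI_power_hypercycle:
  assumes "n \<ge> 2 * d - 1" "n > 0" "1 \<le> k"
  shows "edges ((EI ^^ k) (hypercycle n d)) = {arc n i l | i l. 1 \<le> i \<and> 2 \<le> l \<and> l + k \<le> d}"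
proof (intro subset_antisym subsetI)
  fix e
  assume e: "e \<in> edges ((EI ^^ k) (hypercycle n d))"
  have dn: "d \<le> n" using assms(1,2) by linarith
  obtain i l where il: "1 \<le> i" "l \<le> d" "e = arc n i l"
    using edge_EI_power_hypercycle_arc[OF assms(1,2) e] by blast
  then have "card e = l" using dn by (simp add: card_arc)
  moreover have "card e + k \<le> d"
    using edge_EI_power_upper[OF hypercycle_edge_card[OF dn assms(2)] e] by blast
  moreover have "2 \<le> card e"
    using card_edge_EI_power_ge_2[of e "k - 1" "hypercycle n d"] e assms(3) by simp
  ultimately show "e \<in> {arc n i l | i l. 1 \<le> i \<and> 2 \<le> l \<and> l + k \<le> d}"
    using il by blast
next
  fix e
  assume "e \<in> {arc n i l | i l. 1 \<le> i \<and> 2 \<le> l \<and> l + k \<le> d}"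
  then show "e \<in> edges ((EI ^^ k) (hypercycle n d))"
    using arc_in_EI_power_hypercycle[OF assms(1,2), of _ _ "k - 1"] assms(3)
    by (auto simp del: funpow.simps)
qed

lemma EI_power_hypercycle:
  assumes "n \<ge> 2 * d - 1" "n > 0" "1 \<le> k" "k + 2 \<le> d"
  shows "(EI ^^ k) (hypercycle n d) = hypergraph_Union (hypercycle n ` {2..d - k})"
proof (rule hypergraph.expand, intro conjI)
  have "{2..d - k} \<noteq> {}" using assms(4) by auto
  then show "verts ((EI ^^ k) (hypercycle n d)) = verts (hypergraph_Union (hypercycle n ` {2..d - k}))"
    by (simp add: hypergraph_Union_def hypercycle_def)
  have "l + k \<le> d \<longleftrightarrow> l \<le> d - k" for l using assms(4) by auto
  then show "edges ((EI ^^ k) (hypercycle n d)) = edges (hypergraph_Union (hypercycle n ` {2..d - k}))"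
    unfolding edges_EI_power_hypercycle[OF assms(1-3)]
    by (auto simp: hypergraph_Union_def edges_hypercycle[OF assms(2)]) blast+
qed

lemma EI_number_hypercycle:
  assumes "d \<ge> 2" "n \<ge> 2 * d - 1"
  shows "EI_number (hypercycle n d) = d - 1"
proof -
  have n: "n \<ge> d" "n > 0" using assms by auto
  have "arc n 1 2 \<in> edges ((EI ^^ (d - 2)) (hypercycle n d))"
  \<comment> \<open>For \<open>d = 2\<close> the level is 0, outside the scope of
    \<open>edges_EI_power_hypercycle\<close>.\<close>
  proof (cases "d = 2")
    case True
    then show ?thesis using n by (auto simp: edges_hypercycle)
  next
    case False
    then show ?thesis using assms n by (subst edges_EI_power_hypercycle) force+
  qed
  moreover have "edges ((EI ^^ (d - 1)) (hypercycle n d)) = {}"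
    using hypercycle_edge_card[OF n] assms(1) by (rule EI_power_uniform_edgeless)
  moreover have "Suc (d - 2) = d - 1" using assms(1) by simp
  ultimately show ?thesis
    using EI_number_eqI[of "d - 2" "hypercycle n d"] by (metis empty_iff)
qed

section \<open>Hyperpaths\<close>

lemma hyperpath_edge_card:
  assumes "e \<in> edges (hyperpath n d)"
  shows "finite e \<and> card e \<le> d"
  using assms by (auto simp: hyperpath_def)

text \<open>Intersecting the intervals starting at \<open>i - 1\<close> and \<open>i\<close> costs
  one element and one start at the left end, hence \<open>k < i\<close>; the right-hand bound
  stays.\<close>

lemma interval_in_EI_power_hyperpath:
  assumes "k + 2 \<le> d" "k < i" "i + d \<le> n + 1"
  shows "{i..<i + (d - k)} \<in> edges ((EI ^^ k) (hyperpath n d))"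
  using assms
proof (induction k arbitrary: i)
  case 0
  then show ?case by (auto simp: hyperpath_def)
next
  case (Suc k)
  let ?A = "{i - 1..<i - 1 + (d - k)}" and ?B = "{i..<i + (d - k)}"
  have "?A \<in> edges ((EI ^^ k) (hyperpath n d))" "?B \<in> edges ((EI ^^ k) (hyperpath n d))"
    using Suc.prems by (intro Suc.IH; simp)+
  moreover have "{i..<i + (d - Suc k)} = ?A \<inter> ?B" using Suc.prems by auto
  moreover have "i - 1 \<in> ?A - ?B" using Suc.prems by auto
  moreover have "2 \<le> card {i..<i + (d - Suc k)}" using Suc.prems by simp
  ultimately show ?case unfolding funpow.simps o_apply edges_EI_iff by blast
qed

lemma EI_number_hyperpath_long:
  assumes "d \<ge> 2" "n \<ge> 2 * d - 1"
  shows "EI_number (hyperpath n d) = d - 1"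
proof -
  \<comment> \<open>A two-element edge at the smallest start allowed by \<open>k < i\<close> for
    \<open>k = d - 2\<close>.\<close>
  have "{d - 1..<d - 1 + (d - (d - 2))} \<in> edges ((EI ^^ (d - 2)) (hyperpath n d))"
    using assms by (intro interval_in_EI_power_hyperpath) auto
  moreover have "edges ((EI ^^ (d - 1)) (hyperpath n d)) = {}"
    using hyperpath_edge_card assms(1) by (rule EI_power_uniform_edgeless)
  moreover have "Suc (d - 2) = d - 1" using assms(1) by simp
  ultimately show ?thesis
    using EI_number_eqI[of "d - 2" "hyperpath n d"] by (metis empty_iff)
qed

lemma EI_number_hyperpath_short:
  assumes "n \<ge> d" "n < 2 * d - 1"
  shows "EI_number (hyperpath n d) = n - d + 1"
proof -
  \<comment> \<open>For \<open>k = n - d\<close> only the start \<open>n - d + 1\<close> is allowed;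
    this edge is the central block itself.\<close>
  have "{n - d + 1..<n - d + 1 + (d - (n - d))} \<in> edges ((EI ^^ (n - d)) (hyperpath n d))"
    using assms by (intro interval_in_EI_power_hyperpath) auto
  moreover have False if e: "e \<in> edges ((EI ^^ Suc (n - d)) (hyperpath n d))" for e
  proof -
    have up: "finite e" "card e + Suc (n - d) \<le> d"
      using edge_EI_power_upper[OF hyperpath_edge_card e] by auto
    have "{n - d + 1..d} \<subseteq> e"
      by (rule edge_EI_power_supset[OF _ e]) (auto simp: hyperpath_def)
    \<comment> \<open>The block has \<open>2 * d - n\<close> elements, one more than the upper bound
      on \<open>card e\<close> permits.\<close>
    then have "card {n - d + 1..d} \<le> card e" using up(1) by (rule card_mono[rotated])
    with up(2) assms show False by simp
  qed
  ultimately show ?thesis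
    using EI_number_eqI[of "n - d" "hyperpath n d"] by (metis Suc_eq_plus1 empty_iff equals0I)
qed

theorem theorem4:
  fixes n d :: nat
  assumes "n > 0" and "d > 0"
  shows "(d \<ge> 3 \<and> n \<ge> 2 * d - 1 \<longrightarrow>
      (\<forall>k \<in> {1..d - 2}. (EI ^^ k) (hypercycle n d) = hypergraph_Union (hypercycle n ` {2..d - k}))) \<and>
    (d \<ge> 2 \<and> n \<ge> 2 * d - 1 \<longrightarrow> EI_number (hypercycle n d) = d - 1) \<and>
    (d \<ge> 2 \<and> n \<ge> d \<longrightarrow>
      (n \<ge> 2 * d - 1 \<longrightarrow> EI_number (hyperpath n d) = d - 1) \<and>
      (n < 2 * d - 1 \<longrightarrow> EI_number (hyperpath n d) = n - d + 1))"
proof (intro conjI impI ballI)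
  fix k
  assume "3 \<le> d \<and> 2 * d - 1 \<le> n" "k \<in> {1..d - 2}"
  then show "(EI ^^ k) (hypercycle n d) = hypergraph_Union (hypercycle n ` {2..d - k})"
    using assms(1) by (intro EI_power_hypercycle) auto
qed (use EI_number_hypercycle EI_number_hyperpath_long EI_number_hyperpath_short in auto)

end
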